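(* Let $k\in\mathbb{N}$ with $k\geq 2$, and let $\mathbf{X},\mathbf{A}$ be two finite $k$-enhanced $\sigma$-structures. Then $\mathrm{SA}^k(\mathbf{X},\mathbf{A})$ accepts if and only if there is a homomorphism $\mathbf{X}^{\otimes k}\to\mathbb{F}_{\mathscr{Q}_{\mathrm{conv}}}(\mathbf{A}^{\otimes k})$.
   Context: A signature $\sigma$ is a finite set of relation symbols $R$, each with an arity $\mathrm{ar}(R)\in\mathbb{N}$. A $\sigma$-structure $\mathbf{A}$ has a domain $A$ and relations $R^{\mathbf{A}}\subseteq A^{\mathrm{ar}(R)}$. A homomorphism $\mathbf{A}\to\mathbf{B}$ is a map $h:A\to B$ with $h(\mathbf{a})\in R^{\mathbf{B}}$ (applied coordinatewise) whenever $\mathbf{a}\in R^{\mathbf{A}}$. For $\mathbf{x}=(x_1,\dots,x_k)$ and $\mathbf{i}=(i_1,\dots,i_\ell)\in[k]^\ell$, $\mathbf{x}_{\mathbf{i}}=(x_{i_1},\dots,x_{i_\ell})$, and $\{\mathbf{x}\}=\{x_1,\dots,x_k\}$. A $\sigma$-structure $\mathbf{A}$ is $k$-enhanced if $\sigma$ contains a $k$-ary symbol $R_k$ with $R_k^{\mathbf{A}}=A^k$. Tensor power: for $k\in\mathbb{N}$, $\mathbf{A}^{\otimes k}$ has the same relation symbols as $\sigma$, where a symbol $R$ of arity $r$ now has arity $r^k$ with tuple positions indexed by $[r]^k$; its domain is $A^k$ and $R^{\mathbf{A}^{\otimes k}}=\{\mathbf{a}^{\otimes k}:\mathbf{a}\in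 R^{\mathbf{A}}\}$, where $\mathbf{a}^{\otimes k}$ is the family indexed by $\mathbf{i}\in[r]^k$ whose $\mathbf{i}$-th entry is $\mathbf{a}_{\mathbf{i}}\in A^k$. Maps are applied to such families entrywise. Free structure of $\mathscr{Q}_{\mathrm{conv}}$: for a finite structure $\mathbf{B}$, $\mathbb{F}_{\mathscr{Q}_{\mathrm{conv}}}(\mathbf{B})$ has as domain the set of all functions $v:B\to\mathbb{Q}_{\geq 0}$ with $\sum_{b}v(b)=1$; for a symbol $R$ whose tuple positions are indexed by a set $J$, a family $(v_j)_{j\in J}$ of such functions lies in $R^{\mathbb{F}_{\mathscr{Q}_{\mathrm{conv}}}(\mathbf{B})}$ iff there is $q:R^{\mathbf{B}}\to\mathbb{Q}_{\geq0}$ with $\sum_c q(c)=1$ and $v_j(b)=\sum_{c\in R^{\mathbf{B}},\,c_j=b}q(c)$ for all $j\in J$, $b\in B$. In particular, the domain of $\mathbb{F}_{\mathscr{Q}_{\mathrm{conv}}}(\mathbf{A}^{\otimes k})$ consists of nonnegative rational tensors indexed by $A^k$ with entries summing to $1$, and a family $(M_{\mathbf{i}})_{\mathbf{i}\in[r]^k}$ is in $R^{\mathbb{F}_{\mathscr{Q}_{\mathrm{conv}}}(\mathbf{A}^{\otimes k})}$ iff there is a probability vector $q$ on $R^{\mathbf{A}}$ (rational) with $M_{\mathbf{i}}(\mathbf{a})=\sum_{\mathbf{b}\in R^{\mathbf{A}},\,\mathbf{b}_{\mathbf{i}}=\mathbf{a}}q(\mathbf{b})$ for all $\mathbf{i}\in[r]^k$,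 $\mathbf{a}\in A^k$. Sherali-Adams: for finite $\sigma$-structures $\mathbf{X},\mathbf{A}$, introduce variables $\lambda_V(f)$ for each $V\subseteq X$ with $1\le|V|\le k$ and $f:V\to A$, and $\lambda_{R,\mathbf{x}}(f)$ for each $R\in\sigma$, $\mathbf{x}\in R^{\mathbf{X}}$, $f:\{\mathbf{x}\}\to A$. Constraints: (SA1) $\sum_{f:V\to A}\lambda_V(f)=1$ for all $V$ with $1\le|V|\le k$; (SA2) $\lambda_U(f)=\sum_{g:V\to A,\,g|_U=f}\lambda_V(g)$ for $U\subseteq V\subseteq X$, $1\le |U|$, $|V|\le k$, $f:U\to A$; (SA3) $\lambda_U(f)=\sum_{g:\{\mathbf{x}\}\to A,\,g|_U=f}\lambda_{R,\mathbf{x}}(g)$ for $R\in\sigma$, $\mathbf{x}\in R^{\mathbf{X}}$, $U\subseteq\{\mathbf{x}\}$ with $1\le|U|\le k$, $f:U\to A$; (SA4) $\lambda_{R,\mathbf{x}}(f)=0$ whenever $f(\mathbf{x})\notin R^{\mathbf{A}}$. $\mathrm{SA}^k(\mathbf{X},\mathbf{A})$ accepts if this system has a solution with all variables real in $[0,1]$. *)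

theory Defs
  imports Complex_Main "HOL-Library.FuncSet"
begin

text \<open>Throughout, \<open>[n]\<close> is \<open>{1..n}\<close>, and a tuple or family indexed by \<open>J\<close> with entries in \<open>D\<close> is an
  element of \<open>J \<rightarrow>\<^sub>E D\<close>.\<close>

record 'r signature =
  symbols :: "'r set"
  arity :: "'r \<Rightarrow> nat"

text \<open>Arities are positive integers. With a nullary symbol \<open>R\<close>, neither (SA1) nor (SA3) would
  constrain \<open>\<lambda>\<^bsub>R,()\<^esub>\<close>.\<close>

definition signature :: "'r signature \<Rightarrow> bool" where
  "signature \<sigma> \<longleftrightarrow> finite (symbols \<sigma>) \<and> (\<forall>R\<in>symbols \<sigma>. 1 \<le> arity \<sigma> R)"

text \<open>A structure carries its own symbols together with the index set of the tuple positions of each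
  symbol, so that a structure, its tensor powers (positions \<open>[r]\<^sup>k\<close>) and the free structures over them
  are objects of the same kind.\<close>

record ('r, 'j, 'a) relstruct =
  syms :: "'r set"
  pos :: "'r \<Rightarrow> 'j set"
  universe :: "'a set"
  rel :: "'r \<Rightarrow> ('j \<Rightarrow> 'a) set"

definition sig_structure :: "'r signature \<Rightarrow> ('r, nat, 'a) relstruct \<Rightarrow> bool" where
  "sig_structure \<sigma> A \<longleftrightarrow> syms A = symbols \<sigma> \<and>
     (\<forall>R\<in>symbols \<sigma>. pos A R = {1..arity \<sigma> R} \<and> rel A R \<subseteq> pos A R \<rightarrow>\<^sub>E universe A)"

definition enhanced :: "nat \<Rightarrow> 'r signature \<Rightarrow> ('r, nat, 'a) relstruct \<Rightarrow> bool" where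
  "enhanced k \<sigma> A \<longleftrightarrow>
     (\<exists>R\<in>symbols \<sigma>. arity \<sigma> R = k \<and> rel A R = {1..k} \<rightarrow>\<^sub>E universe A)"

text \<open>Meant for structures \<open>A\<close> and \<open>B\<close> with the same symbols and the same positions.\<close>

definition homomorphism ::
  "('r, 'j, 'a) relstruct \<Rightarrow> ('r, 'j, 'b) relstruct \<Rightarrow> ('a \<Rightarrow> 'b) \<Rightarrow> bool" where
  "homomorphism A B h \<longleftrightarrow> h \<in> universe A \<rightarrow> universe B \<and>
     (\<forall>R\<in>syms A. \<forall>a\<in>rel A R. (\<lambda>j\<in>pos A R. h (a j)) \<in> rel B R)"

definition tensor_tuple :: "nat \<Rightarrow> 'j set \<Rightarrow> ('j \<Rightarrow> 'a) \<Rightarrow> (nat \<Rightarrow> 'j) \<Rightarrow> (nat \<Rightarrow> 'a)" where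
  "tensor_tuple k J a = (\<lambda>i\<in>{1..k} \<rightarrow>\<^sub>E J. \<lambda>p\<in>{1..k}. a (i p))"

definition tensor_power ::
  "nat \<Rightarrow> ('r, 'j, 'a) relstruct \<Rightarrow> ('r, nat \<Rightarrow> 'j, nat \<Rightarrow> 'a) relstruct" where
  "tensor_power k A =
     \<lparr>syms = syms A,
      pos = (\<lambda>R. {1..k} \<rightarrow>\<^sub>E pos A R),
      universe = {1..k} \<rightarrow>\<^sub>E universe A,
      rel = (\<lambda>R. tensor_tuple k (pos A R) ` rel A R)\<rparr>"

definition rat_dists :: "'b set \<Rightarrow> ('b \<Rightarrow> rat) set" where
  "rat_dists S = {v \<in> S \<rightarrow>\<^sub>E {0..}. (\<Sum>b\<in>S. v b) = 1}"

definition free_Qconv :: "('r, 'j, 'b) relstruct \<Rightarrow> ('r, 'j, 'b \<Rightarrow> rat) relstruct" where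
  "free_Qconv B =
     \<lparr>syms = syms B,
      pos = pos B,
      universe = rat_dists (universe B),
      rel = (\<lambda>R. {v \<in> pos B R \<rightarrow>\<^sub>E rat_dists (universe B).
               \<exists>q\<in>rat_dists (rel B R). \<forall>j\<in>pos B R. \<forall>b\<in>universe B.
                 v j b = (\<Sum>c\<in>{c \<in> rel B R. c j = b}. q c)})\<rparr>"

text \<open>In \<open>SA_solution\<close>, \<open>lam V f\<close> is the variable \<open>\<lambda>\<^sub>V(f)\<close> and \<open>mu R x f\<close> is \<open>\<lambda>\<^bsub>R,x\<^esub>(f)\<close>; values outside
  the stated ranges of \<open>V\<close>, \<open>R\<close>, \<open>x\<close>, \<open>f\<close> play no role. The image \<open>x ` pos X R\<close> is the set of entries
  of the tuple \<open>x\<close>. After the two range conditions, the conjuncts are (SA1)--(SA4).\<close>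

definition SA_solution ::
  "nat \<Rightarrow> ('r, 'j, 'x) relstruct \<Rightarrow> ('r, 'j, 'a) relstruct \<Rightarrow>
   ('x set \<Rightarrow> ('x \<Rightarrow> 'a) \<Rightarrow> real) \<Rightarrow> ('r \<Rightarrow> ('j \<Rightarrow> 'x) \<Rightarrow> ('x \<Rightarrow> 'a) \<Rightarrow> real) \<Rightarrow> bool" where
  "SA_solution k X A lam mu \<longleftrightarrow>
     (\<forall>V f. V \<subseteq> universe X \<and> 1 \<le> card V \<and> card V \<le> k \<and> f \<in> V \<rightarrow>\<^sub>E universe A \<longrightarrow>
        lam V f \<in> {0..1}) \<and>
     (\<forall>R\<in>syms X. \<forall>x\<in>rel X R. \<forall>f \<in> x ` pos X R \<rightarrow>\<^sub>E universe A. mu R x f \<in> {0..1}) \<and>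
     (\<forall>V. V \<subseteq> universe X \<and> 1 \<le> card V \<and> card V \<le> k \<longrightarrow>
        (\<Sum>f\<in>V \<rightarrow>\<^sub>E universe A. lam V f) = 1) \<and>
     (\<forall>U V f. U \<subseteq> V \<and> V \<subseteq> universe X \<and> 1 \<le> card U \<and> card V \<le> k \<and> f \<in> U \<rightarrow>\<^sub>E universe A \<longrightarrow>
        lam U f = (\<Sum>g\<in>{g \<in> V \<rightarrow>\<^sub>E universe A. restrict g U = f}. lam V g)) \<and>
     (\<forall>R\<in>syms X. \<forall>x\<in>rel X R. \<forall>U f.
        U \<subseteq> x ` pos X R \<and> 1 \<le> card U \<and> card U \<le> k \<and> f \<in> U \<rightarrow>\<^sub>E universe A \<longrightarrow>
        lam U f = (\<Sum>g\<in>{g \<in> x ` pos X R \<rightarrow>\<^sub>E universe A. restrict g U = f}. mu R x g)) \<and>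
     (\<forall>R\<in>syms X. \<forall>x\<in>rel X R. \<forall>f \<in> x ` pos X R \<rightarrow>\<^sub>E universe A.
        (\<lambda>j\<in>pos X R. f (x j)) \<notin> rel A R \<longrightarrow> mu R x f = 0)"

definition SA_accepts :: "nat \<Rightarrow> ('r, 'j, 'x) relstruct \<Rightarrow> ('r, 'j, 'a) relstruct \<Rightarrow> bool" where
  "SA_accepts k X A \<longleftrightarrow> (\<exists>lam mu. SA_solution k X A lam mu)"

end

theory Submission
  imports Defs
begin

text \<open>
  A solution \<open>\<lambda>\<close> corresponds to the homomorphism \<open>h\<close> with \<open>h(x)(f(x)) = \<lambda>\<^bsub>{x}\<^esub>(f)\<close>, and the variables
  \<open>\<lambda>\<^bsub>R,x\<^esub>\<close> to the probability vector on \<open>R\<^sup>A\<close> witnessing that \<open>h\<close> preserves the tuple \<open>x\<close>. Under this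
  dictionary (SA3) is the marginal condition of the free structure, and (SA4) says that the vector
  lives on \<open>R\<^sup>A\<close>. Conversely, a homomorphism defines a solution because \<open>h(x)\<close> is supported on tuples
  of the form \<open>f(x)\<close>: the full relation of \<open>X\<close> relates \<open>x\<close> to itself through the position tuple
  that reads \<open>x\<^sub>p\<close> in place of an equal entry \<open>x\<^sub>q\<close>. Real solutions become rational ones by applying an
  additive map from the reals to the rationals that preserves the sign of finitely many values.\<close>

section \<open>Rational points from real points\<close>

text \<open>Rounding the elements of a Hamel basis of the reals over the rationals ever more finely gives
  rational-linear maps \<open>\<psi>\<^sub>n\<close> that converge pointwise to the identity, so that \<open>\<psi>\<^sub>n\<close> preserves the sign of
  finitely many given reals for large \<open>n\<close>.\<close>

lemma additive_real_to_rat_nonneg: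
  fixes S :: "real set"
  assumes "finite S"
  obtains \<phi> :: "real \<Rightarrow> rat"
  where "Modules.additive \<phi>" "\<phi> 1 = 1" "\<And>s. s \<in> S \<Longrightarrow> 0 \<le> s \<Longrightarrow> 0 \<le> \<phi> s"
proof -
  let ?scale = "\<lambda>(q::rat) (x::real). of_rat q * x"
  interpret R: vector_space ?scale
    by unfold_locales (simp_all add: algebra_simps of_rat_add of_rat_mult)
  interpret Q: vector_space "(*) :: rat \<Rightarrow> rat \<Rightarrow> rat"
    by unfold_locales (simp_all add: algebra_simps)
  interpret RQ: vector_space_pair ?scale "(*) :: rat \<Rightarrow> rat \<Rightarrow> rat"
    by unfold_locales
  obtain B where indep: "R.independent B" and span: "R.span B = UNIV"
    using R.maximal_independent_subset[of UNIV] by (metis top.extremum_uniqueI)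
  have ex: "\<exists>t::rat. \<bar>of_rat t - b\<bar> < inverse (real (Suc n))" for b n
  proof -
    obtain t where "b - inverse (real (Suc n)) < of_rat t" "of_rat t < b"
      using of_rat_dense[of "b - inverse (real (Suc n))" b] by auto
    then show ?thesis by (intro exI[of _ t]) simp
  qed
  \<comment> \<open>Rational approximations with error below 1/(n+1). They are chosen for every
    real, but \<open>\<psi> n\<close> takes its values from \<open>t n\<close> only on the Hamel
    basis \<open>B\<close>.\<close>
  define t :: "nat \<Rightarrow> real \<Rightarrow> rat"
    where "t n b = (SOME t. \<bar>of_rat t - b\<bar> < inverse (real (Suc n)))" for n b
  have t: "\<bar>of_rat (t n b) - b\<bar> < inverse (real (Suc n))" for n b
    unfolding t_def by (rule someI_ex[OF ex])
  have t_lim: "(\<lambda>n. of_rat (t n b)) \<longlonglongrightarrow> b" for b :: real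
  proof -
    have "(\<lambda>n. of_rat (t n b) - b) \<longlonglongrightarrow> 0"
      by (rule tendsto_0_le[OF LIMSEQ_inverse_real_of_nat, where K = 1])
        (use t in \<open>auto intro!: always_eventually less_imp_le\<close>)
    then show ?thesis by (simp add: LIM_zero_iff)
  qed
  define \<psi> where "\<psi> n = RQ.construct B (t n)" for n
  have lin: "Vector_Spaces.linear ?scale (*) (\<psi> n)" for n
    unfolding \<psi>_def by (rule RQ.linear_construct[OF indep])
  have add: "Modules.additive (\<psi> n)" for n
    using RQ.linear_add[OF lin] by (simp add: additive_def)
  \<comment> \<open>The expansion of \<open>s\<close> in the basis has finitely many terms and does
    not depend on \<open>n\<close>, so convergence on basis elements suffices.\<close>
  have lim: "(\<lambda>n. of_rat (\<psi> n s)) \<longlonglongrightarrow> s" for s :: real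
  proof -
    let ?r = "R.representation B s" and ?I = "{b. R.representation B s b \<noteq> 0}"
    have s: "(\<Sum>b\<in>?I. of_rat (?r b) * b) = s"
      using R.sum_nonzero_representation_eq[OF indep] span by simp
    have "\<psi> n s = (\<Sum>b\<in>?I. ?r b * t n b)" for n
    proof -
      have "\<psi> n s = \<psi> n (\<Sum>b\<in>?I. of_rat (?r b) * b)" by (simp only: s)
      also have "\<dots> = (\<Sum>b\<in>?I. \<psi> n (of_rat (?r b) * b))"
        by (rule additive.sum[OF add])
      also have "\<dots> = (\<Sum>b\<in>?I. ?r b * t n b)"
      proof (intro sum.cong refl)
        fix b assume "b \<in> ?I"
        then have "\<psi> n b = t n b"
          using R.representation_ne_zero[of B s b]
          by (simp add: \<psi>_def RQ.construct_basis[OF indep])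
        then show "\<psi> n (of_rat (?r b) * b) = ?r b * t n b"
          by (simp add: RQ.linear_scale[OF lin])
      qed
      finally show ?thesis .
    qed
    then have "(\<lambda>n. of_rat (\<psi> n s)) = (\<lambda>n. \<Sum>b\<in>?I. of_rat (?r b) * of_rat (t n b) :: real)"
      by (simp add: of_rat_sum of_rat_mult)
    also have "\<dots> \<longlonglongrightarrow> (\<Sum>b\<in>?I. of_rat (?r b) * b)"
      by (intro tendsto_sum tendsto_mult tendsto_const t_lim)
    finally show ?thesis by (simp only: s)
  qed
  have "\<forall>\<^sub>F n in sequentially. 0 < \<psi> n s" if "0 < s" for s
    using order_tendstoD(1)[OF lim that] by simp
  \<comment> \<open>Convergence secures strictly positive values only; the value 0 goes to 0 by
    additivity. The number 1 is inserted so that dividing by \<open>\<psi> n 1\<close> is possible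
    and keeps signs.\<close>
  then have "\<forall>\<^sub>F n in sequentially. \<forall>s\<in>{s \<in> insert 1 S. 0 < s}. 0 < \<psi> n s"
    using assms by (intro eventually_ball_finite) auto
  then obtain n where n: "\<And>s. s \<in> insert 1 S \<Longrightarrow> 0 < s \<Longrightarrow> 0 < \<psi> n s"
    by (force simp: eventually_sequentially)
  have pos: "0 < \<psi> n 1" using n by simp
  show thesis
  proof
    show "Modules.additive (\<lambda>s. \<psi> n s / \<psi> n 1)"
      using additive.add[OF add] by (simp add: additive_def add_divide_distrib)
    show "\<psi> n 1 / \<psi> n 1 = 1" using pos by simp
    fix s assume "s \<in> S" "0 \<le> s"
    then show "0 \<le> \<psi> n s / \<psi> n 1"
      using n[of s] pos additive.zero[OF add, of n] by (cases "s = 0") auto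
  qed
qed

section \<open>Rational solutions of Sherali-Adams systems\<close>

lemma sig_structureD:
  assumes "sig_structure \<sigma> A"
  shows "syms A = symbols \<sigma>"
    and "R \<in> symbols \<sigma> \<Longrightarrow> pos A R = {1..arity \<sigma> R}"
    and "R \<in> symbols \<sigma> \<Longrightarrow> rel A R \<subseteq> {1..arity \<sigma> R} \<rightarrow>\<^sub>E universe A"
  using assms by (simp_all add: sig_structure_def) (metis subsetD)+

lemma finite_rel:
  assumes "sig_structure \<sigma> A" "finite (universe A)" "R \<in> symbols \<sigma>"
  shows "finite (rel A R)"
  by (rule finite_subset[OF sig_structureD(3)[OF assms(1,3)]])
    (use assms in \<open>simp add: finite_PiE\<close>)

lemma SA_solutionD:
  assumes "SA_solution k X A lam mu"
  shows "\<And>V f. V \<subseteq> universe X \<Longrightarrow> 1 \<le> card V \<Longrightarrow> card V \<le> k \<Longrightarrow> f \<in> V \<rightarrow>\<^sub>E universe A \<Longrightarrow>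
      lam V f \<in> {0..1}"
    and "\<And>R x f. R \<in> syms X \<Longrightarrow> x \<in> rel X R \<Longrightarrow> f \<in> x ` pos X R \<rightarrow>\<^sub>E universe A \<Longrightarrow>
      mu R x f \<in> {0..1}"
    and "\<And>V. V \<subseteq> universe X \<Longrightarrow> 1 \<le> card V \<Longrightarrow> card V \<le> k \<Longrightarrow>
      (\<Sum>f\<in>V \<rightarrow>\<^sub>E universe A. lam V f) = 1"
    and "\<And>U V f. U \<subseteq> V \<Longrightarrow> V \<subseteq> universe X \<Longrightarrow> 1 \<le> card U \<Longrightarrow> card V \<le> k \<Longrightarrow>
      f \<in> U \<rightarrow>\<^sub>E universe A \<Longrightarrow>
      lam U f = (\<Sum>g\<in>{g \<in> V \<rightarrow>\<^sub>E universe A. restrict g U = f}. lam V g)"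
    and "\<And>R x U f. R \<in> syms X \<Longrightarrow> x \<in> rel X R \<Longrightarrow> U \<subseteq> x ` pos X R \<Longrightarrow> 1 \<le> card U \<Longrightarrow>
      card U \<le> k \<Longrightarrow> f \<in> U \<rightarrow>\<^sub>E universe A \<Longrightarrow>
      lam U f = (\<Sum>g\<in>{g \<in> x ` pos X R \<rightarrow>\<^sub>E universe A. restrict g U = f}. mu R x g)"
    and "\<And>R x f. R \<in> syms X \<Longrightarrow> x \<in> rel X R \<Longrightarrow> f \<in> x ` pos X R \<rightarrow>\<^sub>E universe A \<Longrightarrow>
      (\<lambda>j\<in>pos X R. f (x j)) \<notin> rel A R \<Longrightarrow> mu R x f = 0"
  using assms unfolding SA_solution_def by - (elim conjE; simp)+

text \<open>The equations of the system are linear with rational coefficients, so an additive map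
  fixing 1 preserves them. Only the bounds 0 and 1 need care, and they concern finitely many
  values.\<close>

lemma SA_accepts_iff_rational:
  fixes X :: "('r, nat, 'x) relstruct" and A :: "('r, nat, 'a) relstruct"
  assumes sig: "signature \<sigma>" "sig_structure \<sigma> X"
    and finX: "finite (universe X)" and finA: "finite (universe A)"
  shows "SA_accepts k X A \<longleftrightarrow>
    (\<exists>L M. SA_solution k X A (\<lambda>V f. of_rat (L V f)) (\<lambda>R x f. of_rat (M R x f)))"
proof
  assume "SA_accepts k X A"
  then obtain lam mu where sol: "SA_solution k X A lam mu"
    by (auto simp: SA_accepts_def)
  define S where "S = (\<Union>V\<in>Pow (universe X). lam V ` (V \<rightarrow>\<^sub>E universe A)) \<union>
    (\<Union>R\<in>syms X. \<Union>x\<in>rel X R. mu R x ` (x ` pos X R \<rightarrow>\<^sub>E universe A))"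
  have "finite S"
    unfolding S_def using sig finX finA finite_rel[OF sig(2) finX]
    by (intro finite_UnI finite_UN_I finite_imageI finite_PiE)
      (auto simp: signature_def sig_structureD[OF sig(2)] intro: finite_subset)
  \<comment> \<open>The upper bound on \<open>s\<close> is the nonnegativity of
    \<open>1 - s\<close>, hence the complements.\<close>
  then have "finite (S \<union> (\<lambda>s. 1 - s) ` S)" by simp
  from additive_real_to_rat_nonneg[OF this] obtain \<phi> :: "real \<Rightarrow> rat"
    where add: "Modules.additive \<phi>" and one: "\<phi> 1 = 1"
    and nonneg: "\<And>s. s \<in> S \<union> (\<lambda>s. 1 - s) ` S \<Longrightarrow> 0 \<le> s \<Longrightarrow> 0 \<le> \<phi> s"
    by blast
  have unit: "0 \<le> \<phi> s \<and> \<phi> s \<le> 1" if "s \<in> S" "s \<in> {0..1}" for s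
    using that nonneg[of s] nonneg[of "1 - s"] additive.diff[OF add, of 1 s] one by auto
  have sum: "(\<Sum>i\<in>I. of_rat (\<phi> (F i))) = (of_rat (\<phi> (sum F I)) :: real)"
    for F :: "('x \<Rightarrow> 'a) \<Rightarrow> real" and I
    by (simp add: additive.sum[OF add] of_rat_sum)
  have "SA_solution k X A (\<lambda>V f. of_rat (\<phi> (lam V f))) (\<lambda>R x f. of_rat (\<phi> (mu R x f)))"
    unfolding SA_solution_def sum
  proof (intro conjI allI ballI impI; (elim conjE)?)
    fix V f assume "V \<subseteq> universe X" "1 \<le> card V" "card V \<le> k" "f \<in> V \<rightarrow>\<^sub>E universe A"
    then have "lam V f \<in> S" "lam V f \<in> {0..1}"
      using SA_solutionD(1)[OF sol] unfolding S_def by blast+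
    then show "real_of_rat (\<phi> (lam V f)) \<in> {0..1}" using unit by simp
  next
    fix R x f assume *: "R \<in> syms X" "x \<in> rel X R" "f \<in> x ` pos X R \<rightarrow>\<^sub>E universe A"
    then have "mu R x f \<in> S" unfolding S_def by blast
    moreover have "mu R x f \<in> {0..1}" using SA_solutionD(2)[OF sol *] .
    ultimately show "real_of_rat (\<phi> (mu R x f)) \<in> {0..1}" using unit by simp
  next
    fix V assume "V \<subseteq> universe X" "1 \<le> card V" "card V \<le> k"
    then have "(\<Sum>f\<in>V \<rightarrow>\<^sub>E universe A. lam V f) = 1"
      by (rule SA_solutionD(3)[OF sol])
    then show "real_of_rat (\<phi> (\<Sum>f\<in>V \<rightarrow>\<^sub>E universe A. lam V f)) = 1" by (simp add: one)
  next
    fix U V f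
    assume "U \<subseteq> V" "V \<subseteq> universe X" "1 \<le> card U" "card V \<le> k" "f \<in> U \<rightarrow>\<^sub>E universe A"
    then have "lam U f = (\<Sum>g\<in>{g \<in> V \<rightarrow>\<^sub>E universe A. restrict g U = f}. lam V g)"
      by (rule SA_solutionD(4)[OF sol])
    then show "real_of_rat (\<phi> (lam U f)) =
        of_rat (\<phi> (\<Sum>g\<in>{g \<in> V \<rightarrow>\<^sub>E universe A. restrict g U = f}. lam V g))" by simp
  next
    fix R x U f
    assume "R \<in> syms X" "x \<in> rel X R" "U \<subseteq> x ` pos X R" "1 \<le> card U" "card U \<le> k"
      "f \<in> U \<rightarrow>\<^sub>E universe A"
    then have "lam U f = (\<Sum>g\<in>{g \<in> x ` pos X R \<rightarrow>\<^sub>E universe A. restrict g U = f}. mu R x g)"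
      by (rule SA_solutionD(5)[OF sol])
    then show "real_of_rat (\<phi> (lam U f)) =
        of_rat (\<phi> (\<Sum>g\<in>{g \<in> x ` pos X R \<rightarrow>\<^sub>E universe A. restrict g U = f}. mu R x g))" by simp
  next
    fix R x f
    assume "R \<in> syms X" "x \<in> rel X R" "f \<in> x ` pos X R \<rightarrow>\<^sub>E universe A"
      "(\<lambda>j\<in>pos X R. f (x j)) \<notin> rel A R"
    then have "mu R x f = 0" by (rule SA_solutionD(6)[OF sol])
    then show "real_of_rat (\<phi> (mu R x f)) = 0" by (simp add: additive.zero[OF add])
  qed
  then show "\<exists>L M. SA_solution k X A (\<lambda>V f. of_rat (L V f)) (\<lambda>R x f. of_rat (M R x f))"
    by (intro exI)
qed (auto simp: SA_accepts_def)

section \<open>Homomorphisms from tensor powers\<close>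

text \<open>The tuple \<open>x\<^sub>i\<close> of the paper is \<open>compose {1..k} x i\<close>.\<close>

lemma tensor_tuple_apply:
  "i \<in> {1..k} \<rightarrow>\<^sub>E J \<Longrightarrow> tensor_tuple k J a i = compose {1..k} a i"
  by (simp add: tensor_tuple_def compose_def)

lemma compose_PiE: "i \<in> I \<rightarrow>\<^sub>E J \<Longrightarrow> x \<in> J \<rightarrow>\<^sub>E D \<Longrightarrow> compose I x i \<in> I \<rightarrow>\<^sub>E D"
  by (auto simp: compose_def PiE_iff)

text \<open>The entry of the family at the constant position tuple \<open>(j,...,j)\<close> is the
  constant tuple of value \<open>a j\<close>; since \<open>k \<ge> 1\<close> it has a coordinate to
  read this value from.\<close>

lemma inj_on_tensor_tuple:
  assumes "k \<ge> 1"
  shows "inj_on (tensor_tuple k J) (J \<rightarrow>\<^sub>E D)"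
proof (rule inj_onI)
  fix a b assume ab: "a \<in> J \<rightarrow>\<^sub>E D" "b \<in> J \<rightarrow>\<^sub>E D" and eq: "tensor_tuple k J a = tensor_tuple k J b"
  show "a = b"
  proof (rule PiE_ext[OF ab])
    fix j assume "j \<in> J"
    then have "c j = tensor_tuple k J c (\<lambda>p\<in>{1..k}. j) 1" for c :: "'a \<Rightarrow> 'b"
      using assms by (simp add: tensor_tuple_def)
    then show "a j = b j" using eq by metis
  qed
qed

text \<open>The probability vector of the free structure over a tensor power, moved to the original
  relation \<open>T\<close>. Unlike members of \<open>rat_dists\<close>, \<open>q\<close> is
  unconstrained outside \<open>T\<close>, so formulas can define it directly.\<close>

definition tensor_witness ::
  "nat \<Rightarrow> 'j set \<Rightarrow> 'a set \<Rightarrow> ('j \<Rightarrow> 'a) set \<Rightarrow> ((nat \<Rightarrow> 'x) \<Rightarrow> (nat \<Rightarrow> 'a) \<Rightarrow> rat) \<Rightarrow>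
   ('j \<Rightarrow> 'x) \<Rightarrow> (('j \<Rightarrow> 'a) \<Rightarrow> rat) \<Rightarrow> bool" where
  "tensor_witness k J D T h x q \<longleftrightarrow> (\<forall>b\<in>T. 0 \<le> q b) \<and> sum q T = 1 \<and>
     (\<forall>i\<in>{1..k} \<rightarrow>\<^sub>E J. \<forall>a\<in>{1..k} \<rightarrow>\<^sub>E D.
        h (compose {1..k} x i) a = (\<Sum>b\<in>{b \<in> T. compose {1..k} b i = a}. q b))"

lemma tensor_witness_cong:
  assumes "\<And>b. b \<in> T \<Longrightarrow> q b = q' b"
  shows "tensor_witness k J D T h x q \<longleftrightarrow> tensor_witness k J D T h x q'"
proof -
  have "sum q {b \<in> T. P b} = sum q' {b \<in> T. P b}" for P
    using assms by (intro sum.cong) auto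
  moreover have "sum q T = sum q' T" using assms by (intro sum.cong) auto
  ultimately show ?thesis using assms by (simp add: tensor_witness_def)
qed

text \<open>Because \<open>tensor_tuple\<close> is injective on tuples, weights on the tensored
  relation and weights on \<open>rel A R\<close> correspond one to one, with equal
  marginals.\<close>

lemma tensor_rel_free_Qconv_iff:
  fixes A :: "('r, 'j, 'a) relstruct" and h :: "(nat \<Rightarrow> 'x) \<Rightarrow> (nat \<Rightarrow> 'a) \<Rightarrow> rat"
  assumes k: "k \<ge> 1" and T: "rel A R \<subseteq> pos A R \<rightarrow>\<^sub>E universe A"
    and h: "h \<in> ({1..k} \<rightarrow>\<^sub>E E) \<rightarrow> rat_dists ({1..k} \<rightarrow>\<^sub>E universe A)"
    and x: "x \<in> pos A R \<rightarrow>\<^sub>E E"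
  shows "(\<lambda>i\<in>{1..k} \<rightarrow>\<^sub>E pos A R. h (tensor_tuple k (pos A R) x i))
      \<in> rel (free_Qconv (tensor_power k A)) R \<longleftrightarrow>
    (\<exists>q. tensor_witness k (pos A R) (universe A) (rel A R) h x q)"
proof -
  define J D T where "J = pos A R" and "D = ({1..k} \<rightarrow>\<^sub>E universe A)" and "T = rel A R"
  define t where "t = (tensor_tuple k J :: ('j \<Rightarrow> 'a) \<Rightarrow> _)"
  let ?dist = "\<lambda>q. (\<forall>c\<in>t ` T. 0 \<le> q c) \<and> sum q (t ` T) = (1::rat) \<and>
      (\<forall>i\<in>{1..k} \<rightarrow>\<^sub>E J. \<forall>a\<in>D. h (compose {1..k} x i) a = sum q {c \<in> t ` T. c i = a})"
  have inj: "inj_on t T"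
    using inj_on_tensor_tuple[OF k] T inj_on_subset unfolding t_def J_def T_def by blast
  have fam: "(\<lambda>i\<in>{1..k} \<rightarrow>\<^sub>E J. h (tensor_tuple k J x i)) \<in> ({1..k} \<rightarrow>\<^sub>E J) \<rightarrow>\<^sub>E rat_dists D"
  proof (rule restrict_PiE_iff[THEN iffD2], rule ballI)
    fix i assume i: "i \<in> {1..k} \<rightarrow>\<^sub>E J"
    show "h (tensor_tuple k J x i) \<in> rat_dists D"
      using h compose_PiE[OF i x[folded J_def]] by (auto simp: tensor_tuple_apply[OF i] D_def)
  qed
  have pull: "tensor_witness k J (universe A) T h x (\<lambda>b. q (t b)) \<longleftrightarrow> ?dist q" for q
  proof -
    have "(\<Sum>b\<in>{b \<in> T. compose {1..k} b i = a}. q (t b)) = sum q {c \<in> t ` T. c i = a}"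
      if i: "i \<in> {1..k} \<rightarrow>\<^sub>E J" for i a
    proof -
      have "{c \<in> t ` T. c i = a} = t ` {b \<in> T. compose {1..k} b i = a}"
        by (auto simp: t_def tensor_tuple_apply[OF i])
      moreover have "inj_on t {b \<in> T. compose {1..k} b i = a}"
        using inj by (rule inj_on_subset) auto
      ultimately show ?thesis by (simp add: sum.reindex)
    qed
    moreover have "(\<Sum>b\<in>T. q (t b)) = sum q (t ` T)" by (simp add: sum.reindex[OF inj])
    ultimately show ?thesis by (simp add: tensor_witness_def D_def)
  qed
  have "(\<lambda>i\<in>{1..k} \<rightarrow>\<^sub>E J. h (tensor_tuple k J x i)) \<in> rel (free_Qconv (tensor_power k A)) R \<longleftrightarrow>
      (\<exists>q\<in>rat_dists (t ` T). ?dist q)"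
    using fam unfolding free_Qconv_def tensor_power_def rat_dists_def
    by (simp add: t_def J_def T_def D_def tensor_tuple_apply PiE_iff)
  also have "\<dots> \<longleftrightarrow> (\<exists>q. ?dist q)"
  proof (intro iffI; elim bexE exE)
    fix q assume q: "?dist q"
    have "sum (restrict q (t ` T)) {c \<in> t ` T. P c} = sum q {c \<in> t ` T. P c}" for P
      by (intro sum.cong) auto
    then have "?dist (restrict q (t ` T))" using q by simp
    moreover from this have "restrict q (t ` T) \<in> rat_dists (t ` T)"
      by (auto simp: rat_dists_def)
    ultimately show "\<exists>q\<in>rat_dists (t ` T). ?dist q" by blast
  qed blast
  also have "\<dots> \<longleftrightarrow> (\<exists>q. tensor_witness k J (universe A) T h x q)"
  proof (intro iffI; elim exE)
    fix q assume q: "tensor_witness k J (universe A) T h x q"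
    \<comment> \<open>\<open>pull\<close> applies to vectors that factor through \<open>t\<close>,
      so \<open>q\<close> is first rewritten, on \<open>T\<close>, as one that does.\<close>
    have "tensor_witness k J (universe A) T h x (\<lambda>b. q (inv_into T t (t b)))"
      by (rule tensor_witness_cong[THEN iffD1, OF _ q]) (simp add: inj)
    then have "?dist (\<lambda>c. q (inv_into T t c))"
      by (rule pull[of "\<lambda>c. q (inv_into T t c)", THEN iffD1])
    then show "\<exists>q. ?dist q" by (rule exI[where P = ?dist])
  next
    fix q assume "?dist q"
    then have "tensor_witness k J (universe A) T h x (\<lambda>b. q (t b))" by (rule pull[THEN iffD2])
    then show "\<exists>q. tensor_witness k J (universe A) T h x q" by blast
  qed
  finally show ?thesis by (simp only: J_def T_def)
qed

text \<open>Both directions of the equivalence handle homomorphisms in this form only.\<close>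

lemma homomorphism_tensor_power_iff:
  assumes k: "k \<ge> 1" and sigX: "sig_structure \<sigma> X" and sigA: "sig_structure \<sigma> A"
  shows "homomorphism (tensor_power k X) (free_Qconv (tensor_power k A)) h \<longleftrightarrow>
    h \<in> ({1..k} \<rightarrow>\<^sub>E universe X) \<rightarrow> rat_dists ({1..k} \<rightarrow>\<^sub>E universe A) \<and>
    (\<forall>R\<in>symbols \<sigma>. \<forall>x\<in>rel X R. \<exists>q.
       tensor_witness k {1..arity \<sigma> R} (universe A) (rel A R) h x q)"
    (is "?L \<longleftrightarrow> ?h \<and> ?W")
proof -
  have "?L \<longleftrightarrow> ?h \<and> (\<forall>R\<in>symbols \<sigma>. \<forall>x\<in>rel X R.
      (\<lambda>i\<in>{1..k} \<rightarrow>\<^sub>E {1..arity \<sigma> R}. h (tensor_tuple k {1..arity \<sigma> R} x i))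
        \<in> rel (free_Qconv (tensor_power k A)) R)"
    unfolding homomorphism_def
    by (simp add: tensor_power_def free_Qconv_def sig_structureD[OF sigX] cong: ball_cong)
  moreover have "(\<lambda>i\<in>{1..k} \<rightarrow>\<^sub>E {1..arity \<sigma> R}. h (tensor_tuple k {1..arity \<sigma> R} x i))
        \<in> rel (free_Qconv (tensor_power k A)) R \<longleftrightarrow>
      (\<exists>q. tensor_witness k {1..arity \<sigma> R} (universe A) (rel A R) h x q)"
    if R: "R \<in> symbols \<sigma>" and x: "x \<in> rel X R" and h: ?h for R x
    using tensor_rel_free_Qconv_iff[OF k _ h, of R x] sig_structureD(2,3)[OF sigA R]
      subsetD[OF sig_structureD(3)[OF sigX R] x] by simp
  ultimately show ?thesis by blast
qed

section \<open>From Sherali--Adams solutions to homomorphisms\<close>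

text \<open>The mass of an event under the image of \<open>m\<close> by \<open>F\<close>. Mass that
  \<open>F\<close> sends outside \<open>T\<close> is lost, which is why \<open>F f \<in> T\<close>
  stays on the right.\<close>

lemma sum_pushforward:
  assumes "finite S" "finite T"
  shows "(\<Sum>b\<in>{b \<in> T. P b}. \<Sum>f\<in>{f \<in> S. F f = b}. m f) = (\<Sum>f\<in>{f \<in> S. F f \<in> T \<and> P (F f)}. m f)"
proof -
  let ?S = "{f \<in> S. F f \<in> T \<and> P (F f)}" and ?T = "{b \<in> T. P b}"
  have "(\<Sum>b\<in>?T. \<Sum>f\<in>{f \<in> S. F f = b}. m f) = (\<Sum>b\<in>?T. \<Sum>f\<in>{f \<in> ?S. F f = b}. m f)"
    by (intro sum.cong refl) auto
  also have "\<dots> = sum m ?S" using assms by (intro sum.group) auto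
  finally show ?thesis .
qed

lemma card_image_bounds:
  assumes "k \<ge> 1"
  shows "1 \<le> card (x ` {1..k})" "card (x ` {1..k}) \<le> k"
proof -
  have "x ` {1..k} \<noteq> {}" using assms by auto
  then show "1 \<le> card (x ` {1..k})" by (simp add: Suc_le_eq card_gt_0_iff)
  show "card (x ` {1..k}) \<le> k" using card_image_le[of "{1..k}" x] by simp
qed

text \<open>Take \<open>h x\<close> and the witness \<open>q\<close> to be the images of
  \<lambda>_{x} and \<lambda>_{R,x} under evaluation at \<open>x\<close>. By (SA3), both sides of
  the witness identity are then marginals of the same weights \<open>M R x\<close>.\<close>

lemma rational_SA_imp_homomorphism:
  fixes L :: "'x set \<Rightarrow> ('x \<Rightarrow> 'a) \<Rightarrow> rat"
  assumes k: "k \<ge> 1" and sig: "signature \<sigma>"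
    and sigX: "sig_structure \<sigma> X" and finX: "finite (universe X)"
    and sigA: "sig_structure \<sigma> A" and finA: "finite (universe A)"
    and sol: "SA_solution k X A (\<lambda>V f. of_rat (L V f)) (\<lambda>R x f. of_rat (M R x f))"
  obtains h where "homomorphism (tensor_power k X) (free_Qconv (tensor_power k A)) h"
proof -
  let ?U = "universe A" and ?D = "{1..k} \<rightarrow>\<^sub>E universe A"
  note sol = SA_solutionD[OF sol, unfolded of_rat_sum[symmetric] of_rat_eq_iff of_rat_eq_0_iff
      of_rat_eq_1_iff sig_structureD(1)[OF sigX]]
  have L_nonneg: "0 \<le> L V f"
    if "V \<subseteq> universe X" "1 \<le> card V" "card V \<le> k" "f \<in> V \<rightarrow>\<^sub>E ?U" for V f
  proof -
    have "real_of_rat (L V f) \<in> {0..1}" by (rule sol(1)[OF that])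
    then show ?thesis by simp
  qed
  have SA1: "(\<Sum>f\<in>V \<rightarrow>\<^sub>E ?U. L V f) = 1"
    if "V \<subseteq> universe X" "1 \<le> card V" "card V \<le> k" for V
    by (rule sol(3)[OF that])
  \<comment> \<open>At most one \<open>f\<close> on the entries of \<open>x\<close> satisfies
    \<open>f(x) = a\<close>, and none does if \<open>a\<close> separates equal entries of
    \<open>x\<close>. The sum covers both cases.\<close>
  define h where "h x = (\<lambda>a\<in>?D. \<Sum>f\<in>{f \<in> x ` {1..k} \<rightarrow>\<^sub>E ?U. compose {1..k} f x = a}. L (x ` {1..k}) f)"
    for x
  have "h x \<in> rat_dists ?D" if x: "x \<in> {1..k} \<rightarrow>\<^sub>E universe X" for x
  proof -
    let ?V = "x ` {1..k}"
    have V: "?V \<subseteq> universe X" "1 \<le> card ?V" "card ?V \<le> k"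
      using x card_image_bounds[OF k] by auto
    have "(\<lambda>f. compose {1..k} f x) ` (?V \<rightarrow>\<^sub>E ?U) \<subseteq> ?D"
      by (auto simp: compose_def PiE_iff)
    then have "(\<Sum>a\<in>?D. h x a) = (\<Sum>f\<in>?V \<rightarrow>\<^sub>E ?U. L ?V f)"
      unfolding h_def using finA by (simp add: sum.group finite_PiE)
    then show ?thesis
      using SA1[OF V] L_nonneg[OF V] by (auto simp: rat_dists_def h_def intro!: sum_nonneg)
  qed
  moreover have "\<exists>q. tensor_witness k {1..arity \<sigma> R} ?U (rel A R) h x q"
    if R: "R \<in> symbols \<sigma>" and xR: "x \<in> rel X R" for R x
  proof -
    define J W where "J = {1..arity \<sigma> R}" and "W = x ` J"
    have x: "x \<in> J \<rightarrow>\<^sub>E universe X"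
      using sig_structureD(3)[OF sigX R] xR by (auto simp: J_def)
    have posX: "pos X R = J" using sig_structureD(2)[OF sigX R] by (simp add: J_def)
    have finT: "finite (rel A R)" using finite_rel[OF sigA finA R] .
    have finW: "finite (W \<rightarrow>\<^sub>E ?U)" using finA by (simp add: finite_PiE W_def J_def)
    have M_nonneg: "0 \<le> M R x g" if "g \<in> W \<rightarrow>\<^sub>E ?U" for g
    proof -
      have "real_of_rat (M R x g) \<in> {0..1}"
        using that unfolding W_def posX[symmetric] by (rule sol(2)[OF R xR])
      then show ?thesis by simp
    qed
    have SA3: "L U f = (\<Sum>g\<in>{g \<in> W \<rightarrow>\<^sub>E ?U. restrict g U = f}. M R x g)"
      if "U \<subseteq> W" "1 \<le> card U" "card U \<le> k" "f \<in> U \<rightarrow>\<^sub>E ?U" for U f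
      using that unfolding W_def posX[symmetric] by (rule sol(5)[OF R xR])
    have SA4: "M R x g = 0" if "g \<in> W \<rightarrow>\<^sub>E ?U" "compose J g x \<notin> rel A R" for g
      using that unfolding W_def posX[symmetric] compose_def by (rule sol(6)[OF R xR])
    define q where "q b = (\<Sum>g\<in>{g \<in> W \<rightarrow>\<^sub>E ?U. compose J g x = b}. M R x g)" for b
    \<comment> \<open>Assignments \<open>g\<close> with \<open>g(x)\<close> outside
      \<open>rel A R\<close> are missed on the left; by (SA4) they weigh nothing.\<close>
    have q_sum: "sum q {b \<in> rel A R. P b} = (\<Sum>g\<in>{g \<in> W \<rightarrow>\<^sub>E ?U. P (compose J g x)}. M R x g)" for P
      unfolding q_def sum_pushforward[OF finW finT]
      using finW SA4 by (intro sum.mono_neutral_left) auto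
    have L_sum: "(\<Sum>f\<in>{f \<in> U \<rightarrow>\<^sub>E ?U. P f}. L U f) = (\<Sum>g\<in>{g \<in> W \<rightarrow>\<^sub>E ?U. P (restrict g U)}. M R x g)"
      if U: "U \<subseteq> W" "1 \<le> card U" "card U \<le> k" for U P
    proof -
      have fin: "finite (U \<rightarrow>\<^sub>E ?U)"
        using U finA by (intro finite_PiE) (auto simp: W_def J_def intro: finite_subset)
      have "(\<Sum>f\<in>{f \<in> U \<rightarrow>\<^sub>E ?U. P f}. L U f) =
          (\<Sum>f\<in>{f \<in> U \<rightarrow>\<^sub>E ?U. P f}. \<Sum>g\<in>{g \<in> W \<rightarrow>\<^sub>E ?U. restrict g U = f}. M R x g)"
        using SA3[OF U] by (intro sum.cong) auto
      also have "\<dots> = (\<Sum>g\<in>{g \<in> W \<rightarrow>\<^sub>E ?U. restrict g U \<in> U \<rightarrow>\<^sub>E ?U \<and> P (restrict g U)}. M R x g)"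
        by (rule sum_pushforward[OF finW fin])
      also have "{g \<in> W \<rightarrow>\<^sub>E ?U. restrict g U \<in> U \<rightarrow>\<^sub>E ?U \<and> P (restrict g U)} =
          {g \<in> W \<rightarrow>\<^sub>E ?U. P (restrict g U)}"
        using U(1) by (auto simp: PiE_iff)
      finally show ?thesis .
    qed
    have "tensor_witness k J ?U (rel A R) h x q"
      unfolding tensor_witness_def
    proof (intro conjI ballI)
      show "0 \<le> q b" for b unfolding q_def using M_nonneg by (intro sum_nonneg) auto
      \<comment> \<open>No constraint states the total mass of \<open>M R x\<close> directly. (SA3)
        at the singleton of one entry of \<open>x\<close> equates it with a sum covered by (SA1);
        positive arity supplies that entry.\<close>
      have "1 \<in> J" using sig R by (auto simp: signature_def J_def)
      then have U: "{x 1} \<subseteq> W" by (auto simp: W_def)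
      have "sum q (rel A R) = (\<Sum>g\<in>W \<rightarrow>\<^sub>E ?U. M R x g)" using q_sum[of "\<lambda>_. True"] by simp
      also have "\<dots> = (\<Sum>f\<in>{x 1} \<rightarrow>\<^sub>E ?U. L {x 1} f)" using L_sum[OF U, of "\<lambda>_. True"] k by simp
      also have "\<dots> = 1" using k x \<open>1 \<in> J\<close> by (intro SA1) auto
      finally show "sum q (rel A R) = 1" .
      fix i a assume i: "i \<in> {1..k} \<rightarrow>\<^sub>E J" and a: "a \<in> ?D"
      let ?y = "compose {1..k} x i"
      let ?V = "?y ` {1..k}"
      have V: "?V \<subseteq> W" using i by (auto simp: W_def compose_def)
      \<comment> \<open>Both sides are the \<open>M R x\<close>-mass of the assignments
        \<open>g\<close> whose value on the tuple \<open>?y\<close> is \<open>a\<close>.\<close>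
      have "h ?y a = (\<Sum>g\<in>{g \<in> W \<rightarrow>\<^sub>E ?U. compose {1..k} (restrict g ?V) ?y = a}. M R x g)"
        using a L_sum[OF V card_image_bounds[OF k]] by (simp add: h_def)
      moreover have "compose {1..k} (restrict g ?V) ?y = compose {1..k} (compose J g x) i" for g :: "'x \<Rightarrow> 'a"
        using i by (auto simp: compose_def fun_eq_iff PiE_iff)
      ultimately show "h ?y a = (\<Sum>b\<in>{b \<in> rel A R. compose {1..k} b i = a}. q b)"
        by (simp add: q_sum)
    qed
    then show ?thesis unfolding J_def by blast
  qed
  ultimately show thesis
    using that homomorphism_tensor_power_iff[OF k sigX sigA, of h] by blast
qed

section \<open>From homomorphisms to Sherali--Adams solutions\<close>

text \<open>Turns a set indexing a variable \<lambda>_V into a \<open>k\<close>-tuple at which a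
  homomorphism can be evaluated. Positions beyond \<open>card V\<close> repeat the first
  element.\<close>

lemma obtain_enumeration:
  assumes "finite V" "1 \<le> card V" "card V \<le> k"
  obtains e where "e \<in> {1..k} \<rightarrow>\<^sub>E V" "e ` {1..k} = V"
proof -
  obtain f where f: "bij_betw f {1..card V} V"
    using ex_bij_betw_nat_finite_1[OF assms(1)] by blast
  define e where "e = (\<lambda>p\<in>{1..k}. f (if p \<le> card V then p else 1))"
  have mem: "e p \<in> V" if "p \<in> {1..k}" for p
    using that assms bij_betwE[OF f] by (auto simp: e_def)
  have "V \<subseteq> e ` {1..k}"
  proof
    fix v assume "v \<in> V"
    then obtain p where "p \<in> {1..card V}" "v = f p"
      using f unfolding bij_betw_def by blast
    then show "v \<in> e ` {1..k}" using assms by (intro image_eqI[of _ _ p]) (auto simp: e_def)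
  qed
  show thesis
  proof
    show "e \<in> {1..k} \<rightarrow>\<^sub>E V" using mem by (auto simp: e_def)
    show "e ` {1..k} = V" using mem \<open>V \<subseteq> e ` {1..k}\<close> by blast
  qed
qed

text \<open>Weights on tuples become weights on assignments once all mass sits on tuples that
  respect the equalities among the entries of \<open>x\<close>. The two support facts
  \<open>supp_h\<close> and \<open>supp_q\<close> provide this; the constraints then follow from the
  marginal identities.\<close>

lemma homomorphism_imp_rational_SA:
  fixes X :: "('r, nat, 'x) relstruct" and A :: "('r, nat, 'a) relstruct"
  assumes k: "k \<ge> 2" and sigX: "sig_structure \<sigma> X" and finX: "finite (universe X)"
    and enh: "enhanced k \<sigma> X"
    and sigA: "sig_structure \<sigma> A" and finA: "finite (universe A)"
    and hom: "homomorphism (tensor_power k X) (free_Qconv (tensor_power k A)) h"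
  obtains L M where "SA_solution k X A (\<lambda>V f. of_rat (L V f)) (\<lambda>R x f. of_rat (M R x f))"
proof -
  let ?U = "universe A" and ?K = "{1..k}" and ?J = "\<lambda>R. {1..arity \<sigma> R}"
  let ?D = "?K \<rightarrow>\<^sub>E ?U"
  have "\<forall>R\<in>symbols \<sigma>. \<forall>x\<in>rel X R. \<exists>q. tensor_witness k (?J R) ?U (rel A R) h x q"
    using hom homomorphism_tensor_power_iff[OF _ sigX sigA] k by simp
  then obtain q where q: "\<And>R x. R \<in> symbols \<sigma> \<Longrightarrow> x \<in> rel X R \<Longrightarrow>
      tensor_witness k (?J R) ?U (rel A R) h x (q R x)"
    by metis
  have q_nonneg: "0 \<le> q R x b" if "R \<in> symbols \<sigma>" "x \<in> rel X R" "b \<in> rel A R" for R x b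
    using q[OF that(1,2)] that(3) by (simp add: tensor_witness_def)
  have q_sum: "sum (q R x) (rel A R) = 1" if "R \<in> symbols \<sigma>" "x \<in> rel X R" for R x
    using q[OF that] by (simp add: tensor_witness_def)
  have h_eq: "h (compose ?K x i) a = (\<Sum>b\<in>{b \<in> rel A R. compose ?K b i = a}. q R x b)"
    if "R \<in> symbols \<sigma>" "x \<in> rel X R" "i \<in> ?K \<rightarrow>\<^sub>E ?J R" "a \<in> ?D" for R x i a
    using q[OF that(1,2)] that(3,4) by (simp add: tensor_witness_def)
  have relX: "x \<in> ?J R \<rightarrow>\<^sub>E universe X" if "R \<in> symbols \<sigma>" "x \<in> rel X R" for R x
    using sig_structureD(3)[OF sigX that(1)] that(2) by blast
  have relA: "b \<in> ?J R \<rightarrow>\<^sub>E ?U" if "R \<in> symbols \<sigma>" "b \<in> rel A R" for R b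
    using sig_structureD(3)[OF sigA that(1)] that(2) by blast
  have finT: "finite (rel A R)" if "R \<in> symbols \<sigma>" for R
    using finite_rel[OF sigA finA that] .
  obtain R0 where R0: "R0 \<in> symbols \<sigma>" "arity \<sigma> R0 = k" "rel X R0 = ?K \<rightarrow>\<^sub>E universe X"
    using enh by (auto simp: enhanced_def)

  have supp_h: "a p = a p'"
    if x: "x \<in> ?K \<rightarrow>\<^sub>E universe X" and a: "a \<in> ?D" and nz: "h x a \<noteq> 0"
      and p: "p \<in> ?K" "p' \<in> ?K" and eq: "x p = x p'" for x a p p'
  proof -
    \<comment> \<open>Equality of \<open>x p\<close> and \<open>x p'\<close> makes
      \<open>x_i\<close> equal to \<open>x\<close>. Hence \<open>a\<close> in the support of
      \<open>h x\<close> has the form \<open>b_i\<close>, and both entries in question are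
      \<open>b p\<close>.\<close>
    define i where "i = (\<lambda>l\<in>?K. if l = p' then p else l)"
    have i: "i \<in> ?K \<rightarrow>\<^sub>E ?J R0" using p R0(2) by (auto simp: i_def)
    have "compose ?K x i = x"
      using i eq R0(2) by (intro PiE_ext[OF compose_PiE[OF _ x] x]) (auto simp: compose_def i_def)
    then have "(\<Sum>b\<in>{b \<in> rel A R0. compose ?K b i = a}. q R0 x b) \<noteq> 0"
      using h_eq[OF R0(1) _ i a, of x] x nz R0(3) by simp
    then obtain b where "compose ?K b i = a"
      by (rule sum.not_neutral_contains_not_neutral) blast
    then show ?thesis using p by (auto simp: compose_def i_def)
  qed

  \<comment> \<open>A position tuple reading both \<open>j\<close> and \<open>j'\<close> reduces this to \<open>supp_h\<close>; it needs \<open>k \<ge> 2\<close>.\<close>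
  have supp_q: "b j = b j'"
    if R: "R \<in> symbols \<sigma>" "x \<in> rel X R" and b: "b \<in> rel A R" "q R x b \<noteq> 0"
      and j: "j \<in> ?J R" "j' \<in> ?J R" and eq: "x j = x j'" for R x b j j'
  proof -
    define i where "i = (\<lambda>l\<in>?K. if l = 1 then j else j')"
    have i: "i \<in> ?K \<rightarrow>\<^sub>E ?J R" using j by (auto simp: i_def)
    let ?a = "compose ?K b i" and ?y = "compose ?K x i"
    have a: "?a \<in> ?D" using compose_PiE[OF i relA[OF R(1) b(1)]] .
    have y: "?y \<in> ?K \<rightarrow>\<^sub>E universe X" using compose_PiE[OF i relX[OF R]] .
    \<comment> \<open>Nonnegative weights cannot cancel, so one nonzero weight makes the whole
      marginal nonzero.\<close>
    have "q R x b \<le> (\<Sum>b\<in>{b \<in> rel A R. compose ?K b i = ?a}. q R x b)"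
      using b q_nonneg[OF R] finT[OF R(1)] by (intro member_le_sum) auto
    then have "h ?y ?a \<noteq> 0"
      using h_eq[OF R i a] q_nonneg[OF R b(1)] b(2) by simp
    then have "?a 1 = ?a 2"
      using k eq by (intro supp_h[OF y a]) (auto simp: compose_def i_def)
    then show ?thesis using k by (auto simp: compose_def i_def)
  qed

  \<comment> \<open>The default 0 outside \<open>rel A R\<close> is exactly (SA4).\<close>
  define M where "M R x g =
    (let b = compose (?J R) g x in if b \<in> rel A R then q R x b else 0)" for R x g
  \<comment> \<open>Evaluation at \<open>x\<close> is injective on assignments to the entries of
    \<open>x\<close>, and the tuples it misses have weight zero, so sums over assignments and over
    tuples agree.\<close>
  have M_sum: "(\<Sum>g\<in>{g \<in> x ` ?J R \<rightarrow>\<^sub>E ?U. P (compose (?J R) g x)}. M R x g) =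
      sum (q R x) {b \<in> rel A R. P b}"
    if R: "R \<in> symbols \<sigma>" "x \<in> rel X R" for R x P
  proof -
    let ?W = "x ` ?J R" and ?c = "\<lambda>g. compose (?J R) g x"
    let ?S = "{g \<in> ?W \<rightarrow>\<^sub>E ?U. P (?c g) \<and> ?c g \<in> rel A R}"
    have fin: "finite (?W \<rightarrow>\<^sub>E ?U)" using finA by (simp add: finite_PiE)
    have inj: "inj_on ?c ?S"
    proof (rule inj_onI)
      fix g g' assume g: "g \<in> ?S" "g' \<in> ?S" and eq: "?c g = ?c g'"
      have "g (x j) = g' (x j)" if "j \<in> ?J R" for j
        using fun_cong[OF eq, of j] that by (simp add: compose_def)
      then show "g = g'" using g by (intro PiE_ext[of g ?W "\<lambda>_. ?U" g']) auto
    qed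
    \<comment> \<open>By \<open>supp_q\<close>, a tuple \<open>b\<close> of nonzero weight is
      constant on the fibres of \<open>x\<close>. It therefore factors through \<open>x\<close>, and
      reading it at any chosen preimage yields the assignment \<open>g\<close>.\<close>
    have zero: "q R x b = 0" if b: "b \<in> {b \<in> rel A R. P b} - ?c ` ?S" for b
    proof (rule ccontr)
      assume nz: "q R x b \<noteq> 0"
      have bA: "b \<in> ?J R \<rightarrow>\<^sub>E ?U" using b relA[OF R(1)] by blast
      define g where "g = (\<lambda>w\<in>?W. b (inv_into (?J R) x w))"
      have gW: "g \<in> ?W \<rightarrow>\<^sub>E ?U"
        unfolding g_def by (intro restrict_PiE_iff[THEN iffD2] ballI PiE_mem[OF bA] inv_into_into)
      have "?c g = b"
      proof (rule PiE_ext[OF _ bA])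
        show "?c g \<in> ?J R \<rightarrow>\<^sub>E ?U"
          unfolding compose_def
          by (intro restrict_PiE_iff[THEN iffD2] ballI PiE_mem[OF gW] imageI)
        fix j assume j: "j \<in> ?J R"
        have "b (inv_into (?J R) x (x j)) = b j"
          by (rule supp_q[OF R _ nz inv_into_into[OF imageI[OF j]] j f_inv_into_f[OF imageI[OF j]]])
            (use b in blast)
        then show "?c g j = b j" using j by (simp add: compose_def g_def)
      qed
      then show False using b gW by auto
    qed
    have "(\<Sum>g\<in>{g \<in> ?W \<rightarrow>\<^sub>E ?U. P (?c g)}. M R x g) = (\<Sum>g\<in>?S. q R x (?c g))"
      using fin by (intro sum.mono_neutral_cong_right) (auto simp: M_def)
    also have "\<dots> = sum (q R x) (?c ` ?S)" by (rule sum.reindex[OF inj, unfolded comp_def, symmetric])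
    also have "\<dots> = sum (q R x) {b \<in> rel A R. P b}"
      using finT[OF R(1)] zero by (intro sum.mono_neutral_left) auto
    finally show ?thesis .
  qed
  have M_unit: "M R x g \<in> {0..1}" if R: "R \<in> symbols \<sigma>" "x \<in> rel X R" for R x g
  proof -
    have "q R x b \<le> 1" if "b \<in> rel A R" for b
      using member_le_sum[of b "rel A R" "q R x"] that q_nonneg[OF R] finT[OF R(1)] q_sum[OF R]
      by auto
    then show ?thesis using q_nonneg[OF R] by (auto simp: M_def Let_def)
  qed

  have "\<exists>e. e \<in> ?K \<rightarrow>\<^sub>E V \<and> e ` ?K = V"
    if "V \<subseteq> universe X" "1 \<le> card V" "card V \<le> k" for V
    using obtain_enumeration[OF _ that(2,3)] finite_subset[OF that(1) finX] by metis
  then obtain e where e: "\<And>V. V \<subseteq> universe X \<Longrightarrow> 1 \<le> card V \<Longrightarrow> card V \<le> k \<Longrightarrow>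
      e V \<in> ?K \<rightarrow>\<^sub>E V \<and> e V ` ?K = V"
    by metis
  \<comment> \<open>No compatibility between the enumerations of different sets is required:
    \<open>SA3\<close> holds for any choice.\<close>
  define L where "L V f = h (e V) (compose ?K f (e V))" for V f
  have SA3: "L U f = (\<Sum>g\<in>{g \<in> x ` ?J R \<rightarrow>\<^sub>E ?U. restrict g U = f}. M R x g)"
    if R: "R \<in> symbols \<sigma>" "x \<in> rel X R" and U: "U \<subseteq> x ` ?J R" "1 \<le> card U" "card U \<le> k"
      and f: "f \<in> U \<rightarrow>\<^sub>E ?U" for R x U f
  proof -
    have "U \<subseteq> universe X" using U(1) relX[OF R] by auto
    then have eU: "e U \<in> ?K \<rightarrow>\<^sub>E U" "e U ` ?K = U" using e U(2,3) by auto
    \<comment> \<open>Chosen positions in \<open>x\<close> where the entries of \<open>e U\<close>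
      stand. This makes \<open>e U\<close> the tuple \<open>x_i\<close>, so the marginal identity
      for \<open>x\<close> computes \<open>L U f\<close>.\<close>
    define i where "i = (\<lambda>p\<in>?K. inv_into (?J R) x (e U p))"
    have eW: "e U p \<in> x ` ?J R" if "p \<in> ?K" for p using eU that U(1) by blast
    then have i: "i \<in> ?K \<rightarrow>\<^sub>E ?J R"
      unfolding i_def by (intro restrict_PiE_iff[THEN iffD2] ballI inv_into_into)
    have xi: "x (i p) = e U p" if "p \<in> ?K" for p
      using eW[OF that] that by (simp add: i_def f_inv_into_f)
    \<comment> \<open>Since \<open>e U\<close> lists every element of \<open>U\<close>, agreement
      along this tuple is agreement on \<open>U\<close>.\<close>
    have restrict_iff: "compose ?K (compose (?J R) g x) i = compose ?K f (e U) \<longleftrightarrow> restrict g U = f" for g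
    proof -
      have "compose ?K (compose (?J R) g x) i = compose ?K f (e U) \<longleftrightarrow>
          (\<forall>p\<in>?K. g (e U p) = f (e U p))"
        using i xi by (auto simp: compose_def fun_eq_iff PiE_iff)
      also have "\<dots> \<longleftrightarrow> (\<forall>u\<in>e U ` ?K. g u = f u)" by simp
      also have "\<dots> \<longleftrightarrow> restrict g U = f"
        unfolding eU(2) using f by (auto simp: fun_eq_iff PiE_iff extensional_def)
      finally show ?thesis .
    qed
    have "compose ?K x i = e U"
      by (rule PiE_ext[OF _ eU(1)]) (use xi eU(1) in \<open>auto simp: compose_def\<close>)
    then have "L U f = sum (q R x) {b \<in> rel A R. compose ?K b i = compose ?K f (e U)}"
      using h_eq[OF R i compose_PiE[OF eU(1) f]] by (simp add: L_def)
    also have "\<dots> = (\<Sum>g\<in>{g \<in> x ` ?J R \<rightarrow>\<^sub>E ?U.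
        compose ?K (compose (?J R) g x) i = compose ?K f (e U)}. M R x g)"
      by (rule M_sum[OF R, symmetric])
    also have "\<dots> = (\<Sum>g\<in>{g \<in> x ` ?J R \<rightarrow>\<^sub>E ?U. restrict g U = f}. M R x g)"
      by (simp only: restrict_iff)
    finally show ?thesis .
  qed
  \<comment> \<open>On the full relation, (SA3) turns \<open>L V\<close> into \<open>M R0 (e V)\<close>, so that (SA2) is a case of (SA3).\<close>
  have L_eq: "L U f = (\<Sum>g\<in>{g \<in> V \<rightarrow>\<^sub>E ?U. restrict g U = f}. M R0 (e V) g)"
    if "U \<subseteq> V" "V \<subseteq> universe X" "1 \<le> card U" "card V \<le> k" "f \<in> U \<rightarrow>\<^sub>E ?U" for U V f
  proof -
    \<comment> \<open>Yields the two missing bounds, \<open>1 \<le> card V\<close> and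
      \<open>card U \<le> k\<close>.\<close>
    have card: "card U \<le> card V" using that finX by (meson card_mono finite_subset)
    then have "e V \<in> ?K \<rightarrow>\<^sub>E V" "e V ` ?K = V" using e[of V] that by auto
    moreover from this have "e V \<in> rel X R0" using R0(3) that(2) by auto
    ultimately show ?thesis using SA3[OF R0(1), of "e V" U f] R0(2) that card by simp
  qed
  have L_M: "L V f = M R0 (e V) f" and eV: "e V \<in> rel X R0" "e V ` ?K = V"
    if V: "V \<subseteq> universe X" "1 \<le> card V" "card V \<le> k" and f: "f \<in> V \<rightarrow>\<^sub>E ?U" for V f
  proof -
    have "restrict g V = g" if "g \<in> V \<rightarrow>\<^sub>E ?U" for g
      using that by (simp add: PiE_iff extensional_restrict)
    then have "{g \<in> V \<rightarrow>\<^sub>E ?U. restrict g V = f} = {f}" using f by auto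
    then show "L V f = M R0 (e V) f" using L_eq[of V V f] V f by simp
    show "e V \<in> rel X R0" "e V ` ?K = V" using e[OF V] R0(3) V(1) by auto
  qed

  have "SA_solution k X A (\<lambda>V f. of_rat (L V f)) (\<lambda>R x f. of_rat (M R x f))"
    unfolding SA_solution_def of_rat_sum[symmetric] of_rat_eq_iff of_rat_eq_0_iff of_rat_eq_1_iff
      sig_structureD(1)[OF sigX]
  proof (intro conjI allI ballI impI; (elim conjE)?)
    fix V f assume "V \<subseteq> universe X" "1 \<le> card V" "card V \<le> k" "f \<in> V \<rightarrow>\<^sub>E ?U"
    from L_M[OF this] M_unit[OF R0(1) eV(1)[OF this]] show "real_of_rat (L V f) \<in> {0..1}"
      by simp
  next
    fix R x f assume "R \<in> symbols \<sigma>" "x \<in> rel X R"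
    from M_unit[OF this] show "real_of_rat (M R x f) \<in> {0..1}" by simp
  next
    fix V assume V: "V \<subseteq> universe X" "1 \<le> card V" "card V \<le> k"
    then have eV: "e V \<in> rel X R0" "e V ` ?K = V" using e[OF V] R0(3) by auto
    have "(\<Sum>f\<in>V \<rightarrow>\<^sub>E ?U. L V f) = (\<Sum>f\<in>V \<rightarrow>\<^sub>E ?U. M R0 (e V) f)"
      by (intro sum.cong refl L_M[OF V])
    also have "\<dots> = 1"
      using M_sum[OF R0(1) eV(1), of "\<lambda>_. True"] q_sum[OF R0(1) eV(1)] eV(2) R0(2) by simp
    finally show "(\<Sum>f\<in>V \<rightarrow>\<^sub>E ?U. L V f) = 1" .
  next
    fix U V f
    assume *: "U \<subseteq> V" "V \<subseteq> universe X" "1 \<le> card U" "card V \<le> k" "f \<in> U \<rightarrow>\<^sub>E ?U"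
    have "card U \<le> card V" using * finX by (meson card_mono finite_subset)
    then show "L U f = (\<Sum>g\<in>{g \<in> V \<rightarrow>\<^sub>E ?U. restrict g U = f}. L V g)"
      unfolding L_eq[OF *] using * by (intro sum.cong refl L_M[symmetric]) auto
  next
    fix R x U f
    assume "R \<in> symbols \<sigma>" "x \<in> rel X R" "U \<subseteq> x ` pos X R" "1 \<le> card U" "card U \<le> k"
      "f \<in> U \<rightarrow>\<^sub>E ?U"
    then show "L U f = (\<Sum>g\<in>{g \<in> x ` pos X R \<rightarrow>\<^sub>E ?U. restrict g U = f}. M R x g)"
      using SA3 sig_structureD(2)[OF sigX] by simp
  next
    fix R x f
    assume "R \<in> symbols \<sigma>" "x \<in> rel X R" "(\<lambda>j\<in>pos X R. f (x j)) \<notin> rel A R"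
    then show "M R x f = 0"
      using sig_structureD(2)[OF sigX] by (simp add: M_def compose_def)
  qed
  then show thesis by (rule that)
qed

theorem theorem3p3:
  fixes k :: nat
    and \<sigma> :: "'r signature"
    and X :: "('r, nat, 'x) relstruct"
    and A :: "('r, nat, 'a) relstruct"
  assumes "k \<ge> 2"
    and "signature \<sigma>"
    and "sig_structure \<sigma> X" and "finite (universe X)" and "enhanced k \<sigma> X"
    and "sig_structure \<sigma> A" and "finite (universe A)" and "enhanced k \<sigma> A"
  shows "SA_accepts k X A \<longleftrightarrow>
    (\<exists>h. homomorphism (tensor_power k X) (free_Qconv (tensor_power k A)) h)"
  unfolding SA_accepts_iff_rational[OF assms(2,3,4,7)]
proof
  assume "\<exists>L M. SA_solution k X A (\<lambda>V f. of_rat (L V f)) (\<lambda>R x f. of_rat (M R x f))"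
  then obtain L M where sol: "SA_solution k X A (\<lambda>V f. of_rat (L V f)) (\<lambda>R x f. of_rat (M R x f))"
    by (elim exE)
  have "1 \<le> k" using assms(1) by simp
  then obtain h where "homomorphism (tensor_power k X) (free_Qconv (tensor_power k A)) h"
    by (rule rational_SA_imp_homomorphism[OF _ assms(2,3,4,6,7) sol])
  then show "\<exists>h. homomorphism (tensor_power k X) (free_Qconv (tensor_power k A)) h"
    by blast
next
  assume "\<exists>h. homomorphism (tensor_power k X) (free_Qconv (tensor_power k A)) h"
  then obtain h where hom: "homomorphism (tensor_power k X) (free_Qconv (tensor_power k A)) h" ..
  obtain L M where "SA_solution k X A (\<lambda>V f. of_rat (L V f)) (\<lambda>R x f. of_rat (M R x f))"
    by (rule homomorphism_imp_rational_SA[OF assms(1,3,4,5,6,7) hom])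
  then show "\<exists>L M. SA_solution k X A (\<lambda>V f. of_rat (L V f)) (\<lambda>R x f. of_rat (M R x f))"
    by (intro exI)
qed

end
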